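(* For every integer $m\ge 2$, $$T_m^2 - m = \sum_{k=2}^m c_{mk}\, k(k-1) = 2^m - 2$$ and $$T_m^3 - m = \sum_{k=2}^m c_{mk}\,(k-1)k(k+1) = 3^m - 3.$$
   Context: For an integer $k\ge 2$ let $\psi_k(n) = n + (k-1)(n-1)B_{n-1,k-1}$, where $B_{a,b}=\frac{(a+b)!}{a!\,b!}$, for positive integers $n$; equivalently $\psi_k$ is the polynomial of degree $k$ in $n$ given by $\psi_k(n) = n + \frac{n-1}{(k-2)!}\prod_{j=0}^{k-2}(n+j)$. For $m\ge 2$, the coefficients $c_{mk}$ ($2\le k\le m$) are the unique rational numbers defined by the polynomial identity $n^m = \sum_{k=2}^m c_{mk}\psi_k(n)$. For integers $m\ge 2$ and $\alpha\ge 1$, $T_m^\alpha := \sum_{k=2}^m c_{mk}k^\alpha$ (the superscript in $T_m^\alpha$ is an index, not a power). *)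

theory Defs
  imports "HOL-Computational_Algebra.Polynomial"
begin

definition B :: "nat \<Rightarrow> nat \<Rightarrow> rat" where
  "B a b = fact (a + b) / (fact a * fact b)"

definition psi :: "nat \<Rightarrow> nat \<Rightarrow> rat" where
  "psi k n = of_nat n + (of_nat k - 1) * (of_nat n - 1) * B (n - 1) (k - 1)"

text \<open>The polynomial form of \<open>psi k\<close>: \<open>[:a, 1:]\<close> is \<open>n + a\<close> in the indeterminate \<open>n\<close>.\<close>

definition psi_poly :: "nat \<Rightarrow> rat poly" where
  "psi_poly k = [:0, 1:] + smult (1 / fact (k - 2)) ([:-1, 1:] * (\<Prod>j = 0..k - 2. [:of_nat j, 1:]))"

lemma ge2_obtain:
  assumes "k \<ge> (2::nat)"
  obtains i where "k = Suc (Suc i)"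
  using assms by (metis add_2_eq_Suc le_Suc_ex)

lemma poly_psi_poly:
  assumes "k \<ge> 2" "n \<ge> 1"
  shows "poly (psi_poly k) (of_nat n) = psi k n"
proof -
  obtain i where k: "k = Suc (Suc i)" using assms(1) by (rule ge2_obtain)
  obtain l where n: "n = Suc l" using assms(2) by (cases n) auto
  have *: "(\<Prod>j = 0..i. of_nat j + (1 + of_nat l)) = (fact (l + Suc i) / fact l :: rat)" for i
  proof (induction i)
    case 0
    show ?case by (simp add: add.commute)
  next
    case (Suc i)
    have "(fact (l + Suc (Suc i)) :: rat) = (of_nat (Suc i) + (1 + of_nat l)) * fact (l + Suc i)"
      by (simp add: algebra_simps)
    then show ?case unfolding prod.atLeast0_atMost_Suc Suc.IH by simp
  qed
  have f: "(fact (Suc i) :: rat) = (1 + of_nat i) * fact i" by simp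
  have z: "(1 + of_nat i :: rat) \<noteq> 0" by (metis of_nat_Suc of_nat_0_eq_iff nat.simps(3))
  have "poly (psi_poly k) (of_nat n)
      = 1 + of_nat l + of_nat l * (fact (l + Suc i) / fact l) / fact i"
    unfolding psi_poly_def k n by (simp add: poly_prod * distrib_right add_divide_distrib del: fact_Suc add_Suc_right)
  also have "\<dots> = psi k n"
    unfolding psi_def B_def k n using z
    by (simp add: f del: fact_Suc add_Suc_right)
  finally show ?thesis .
qed

lemma degree_psi_poly:
  assumes "k \<ge> 2"
  shows "degree (psi_poly k) = k"
proof -
  obtain i where k: "k = Suc (Suc i)" using assms by (rule ge2_obtain)
  define P where "P = (\<Prod>j = 0..i. [:of_nat j, 1:] :: rat poly)"
  have d: "degree P = Suc i" unfolding P_def by (subst degree_prod_eq_sum_degree) auto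
  then have "P \<noteq> 0" by auto
  then have "degree (smult (1 / fact i) ([:-1, 1:] * P)) = Suc (Suc i)"
    using d by (simp add: degree_mult_eq del: mult_pCons_left)
  then show ?thesis
    unfolding psi_poly_def k by (simp add: P_def[symmetric] degree_add_eq_right del: mult_pCons_left)
qed

lemma psi_poly_step:
  assumes "k \<ge> 2"
  shows "[:0, 1:] * psi_poly k =
    smult (of_nat k - 1) (psi_poly (Suc k)) - smult (of_nat k - 1) (psi_poly k) + psi_poly 2"
proof -
  obtain i where k: "k = Suc (Suc i)" using assms by (rule ge2_obtain)
  have f: "(fact (Suc i) :: rat) = (1 + of_nat i) * fact i" by simp
  have z: "(1 + of_nat i :: rat) \<noteq> 0" by (metis of_nat_Suc of_nat_0_eq_iff nat.simps(3))
  have "poly ([:0, 1:] * psi_poly k) x =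
    poly (smult (of_nat k - 1) (psi_poly (Suc k)) - smult (of_nat k - 1) (psi_poly k) + psi_poly 2) x" for x
  proof -
    define p where "p = (\<Prod>j = 0..i. of_nat j + x)"
    have 1: "poly (psi_poly k) x = x + (x - 1) * p / fact i"
      unfolding psi_poly_def k by (simp add: poly_prod p_def left_diff_distrib)
    have 2: "poly (psi_poly (Suc k)) x = x + (x - 1) * (p * (x + 1 + of_nat i)) / fact (Suc i)"
      unfolding psi_poly_def k by (simp add: poly_prod p_def algebra_simps add_divide_distrib diff_divide_distrib del: fact_Suc)
    have 3: "poly (psi_poly 2) x = x * x"
      unfolding psi_poly_def by (simp add: algebra_simps)
    have 4: "of_nat k - 1 = (1 + of_nat i :: rat)" unfolding k by simp
    show ?thesis
      by (simp add: 1 2 3 4 f del: fact_Suc) (use z in \<open>simp add: divide_simps\<close>, simp add: algebra_simps)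
  qed
  then show ?thesis by (metis poly_eq_poly_eq_iff ext)
qed

lemma monom_psi_expansion: "\<exists>c. monom 1 (Suc (Suc m)) = (\<Sum>k = 2..Suc (Suc m). smult (c k) (psi_poly k))"
proof (induction m)
  case 0
  have "monom 1 2 = psi_poly 2"
    by (simp add: psi_poly_def monom_altdef power2_eq_square)
  then show ?case by (intro exI[of _ "\<lambda>_. 1"]) (simp add: numeral_2_eq_2)
next
  case (Suc m)
  define M where "M = Suc (Suc m)"
  obtain c where c: "monom 1 M = (\<Sum>k = 2..M. smult (c k) (psi_poly k))"
    using Suc unfolding M_def by blast
  define d where "d k = (if k = 2 then (\<Sum>k = 2..M. c k) else 0)
      + (if k \<ge> 3 then c (k - 1) * (of_nat k - 2) else 0)
      - (if k \<le> M then c k * (of_nat k - 1) else 0)" for k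
  have M: "M \<ge> 2" by (simp add: M_def)
  have "monom 1 (Suc M) = [:0, 1:] * (monom 1 M :: rat poly)"
    by (simp add: monom_Suc)
  also have "\<dots> = (\<Sum>k = 2..M. smult (c k) ([:0, 1:] * psi_poly k))"
    unfolding c by (subst sum_distrib_left) (simp only: mult_smult_right)
  also have "\<dots> = (\<Sum>k = 2..M. smult (c k * (of_nat k - 1)) (psi_poly (Suc k))
      - smult (c k * (of_nat k - 1)) (psi_poly k) + smult (c k) (psi_poly 2))"
    by (intro sum.cong refl, subst psi_poly_step) (auto simp: smult_add_right smult_diff_right)
  also have "\<dots> = (\<Sum>k = 2..M. smult (c k * (of_nat k - 1)) (psi_poly (Suc k)))
      - (\<Sum>k = 2..M. smult (c k * (of_nat k - 1)) (psi_poly k))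
      + smult (\<Sum>k = 2..M. c k) (psi_poly 2)"
    by (simp add: sum.distrib sum_subtractf smult_sum)
  also have "(\<Sum>k = 2..M. smult (c k * (of_nat k - 1)) (psi_poly (Suc k)))
      = (\<Sum>k = Suc 2..Suc M. smult (c (k - 1) * (of_nat k - 2)) (psi_poly k))"
    by (subst sum.shift_bounds_cl_Suc_ivl) (intro sum.cong, auto)
  also have "\<dots> = (\<Sum>k = 2..Suc M. smult (if k \<ge> 3 then c (k - 1) * (of_nat k - 2) else 0) (psi_poly k))"
    by (rule sum.mono_neutral_cong_left) auto
  also have "(\<Sum>k = 2..M. smult (c k * (of_nat k - 1)) (psi_poly k))
      = (\<Sum>k = 2..Suc M. smult (if k \<le> M then c k * (of_nat k - 1) else 0) (psi_poly k))"
    by (rule sum.mono_neutral_cong_left) auto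
  also have "smult (\<Sum>k = 2..M. c k) (psi_poly 2)
      = (\<Sum>k = 2..Suc M. smult (if k = 2 then (\<Sum>k = 2..M. c k) else 0) (psi_poly k))"
    using M by (subst sum.mono_neutral_cong_right[of _ "{2}"]) auto
  finally have "monom 1 (Suc M) = (\<Sum>k = 2..Suc M. smult (d k) (psi_poly k))"
    by (simp only: sum_subtractf[symmetric] sum.distrib[symmetric] d_def
        smult_diff_left[symmetric] smult_add_left[symmetric]) (simp only: algebra_simps)
  then show ?case unfolding M_def by blast
qed

lemma psi_poly_independent:
  assumes "(\<Sum>k = 2..m. smult (c k) (psi_poly k)) = 0" "k \<in> {2..m}"
  shows "c k = 0"
  using assms
proof (induction m)
  case 0
  then show ?case by simp
next
  case (Suc m)
  show ?case
  proof (cases "Suc m \<ge> 2")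
    case False
    then show ?thesis using Suc.prems by simp
  next
    case True
    have low: "coeff (psi_poly j) (Suc m) = 0" if "j \<in> {2..m}" for j
      using that by (intro coeff_eq_0) (simp add: degree_psi_poly)
    have lead: "coeff (psi_poly (Suc m)) (Suc m) \<noteq> 0"
      using degree_psi_poly[OF True] by (metis leading_coeff_0_iff degree_0 nat.simps(3))
    have split: "(\<Sum>k = 2..Suc m. smult (c k) (psi_poly k))
        = (\<Sum>k = 2..m. smult (c k) (psi_poly k)) + smult (c (Suc m)) (psi_poly (Suc m))"
      using True by simp
    have "coeff (\<Sum>k = 2..Suc m. smult (c k) (psi_poly k)) (Suc m) = c (Suc m) * coeff (psi_poly (Suc m)) (Suc m)"
      unfolding split by (simp add: coeff_sum low)
    then have 0: "c (Suc m) = 0" using Suc.prems(1) lead by simp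
    then show ?thesis
      using Suc.IH Suc.prems split by (cases "k = Suc m") auto
  qed
qed

text \<open>The family \<open>k \<mapsto> c\<^sub>m\<^sub>k\<close> is extended by \<open>0\<close> outside \<open>2 \<le> k \<le> m\<close> to make it unique as a function.\<close>

definition is_psi_expansion :: "nat \<Rightarrow> (nat \<Rightarrow> rat) \<Rightarrow> bool" where
  "is_psi_expansion m c \<longleftrightarrow> (\<forall>k. k \<notin> {2..m} \<longrightarrow> c k = 0) \<and>
     monom 1 m = (\<Sum>k = 2..m. smult (c k) (psi_poly k))"

lemma ex1_psi_expansion:
  assumes "m \<ge> 2"
  shows "\<exists>!c. is_psi_expansion m c"
proof -
  obtain c where c: "monom 1 m = (\<Sum>k = 2..m. smult (c k) (psi_poly k))"
    using monom_psi_expansion assms by (metis ge2_obtain)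
  have "is_psi_expansion m (\<lambda>k. if k \<in> {2..m} then c k else 0)"
    unfolding is_psi_expansion_def c by (auto intro!: sum.cong)
  moreover have "c = d" if c: "is_psi_expansion m c" and d: "is_psi_expansion m d" for c d
  proof
    fix k
    have "(\<Sum>k = 2..m. smult (c k - d k) (psi_poly k)) = 0"
      using c d by (simp add: is_psi_expansion_def smult_diff_left sum_subtractf)
    from psi_poly_independent[OF this, of k] show "c k = d k"
      using c d by (cases "k \<in> {2..m}") (auto simp: is_psi_expansion_def)
  qed
  ultimately show ?thesis by blast
qed

definition psi_coeff :: "nat \<Rightarrow> nat \<Rightarrow> rat" where
  "psi_coeff m = (THE c. is_psi_expansion m c)"

lemma is_psi_expansion_psi_coeff:
  "m \<ge> 2 \<Longrightarrow> is_psi_expansion m (psi_coeff m)"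
  unfolding psi_coeff_def by (rule theI'[OF ex1_psi_expansion])

definition T :: "nat \<Rightarrow> nat \<Rightarrow> rat" where
  "T m \<alpha> = (\<Sum>k = 2..m. psi_coeff m k * of_nat k ^ \<alpha>)"

end

theory Submission
  imports Defs
begin

text \<open>
  The coefficients \<open>c\<^sub>m\<^sub>k\<close> need not be computed: every linear functional on polynomials turns
  \<open>n\<^sup>m = (\<Sum>k. c\<^sub>m\<^sub>k \<psi>\<^sub>k(n))\<close> into a numerical identity for them. Evaluation at \<open>1\<close>, \<open>2\<close> and \<open>3\<close>
  uses \<open>\<psi>\<^sub>k(1) = 1\<close>, \<open>\<psi>\<^sub>k(2) = 2 + k(k - 1)\<close> and \<open>\<psi>\<^sub>k(3) = 3 + (k - 1)k(k + 1)\<close>; since the first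
  of these gives \<open>(\<Sum>k. c\<^sub>m\<^sub>k) = 1\<close>, the other two give \<open>2\<^sup>m - 2\<close> and \<open>3\<^sup>m - 3\<close>.
  The link with the power sums \<open>T\<close> is the first moment \<open>(\<Sum>k. c\<^sub>m\<^sub>k k) = m\<close>, because
  \<open>k\<^sup>2 = k(k - 1) + k\<close> and \<open>k\<^sup>3 = (k - 1)k(k + 1) + k\<close>. It comes from a fourth functional, the
  derivative at \<open>1\<close> (lemma \<open>pderiv_psi_poly_1\<close>).
\<close>

lemma poly_psi_expansion:
  assumes "m \<ge> 2" "n \<ge> 1"
  shows "(\<Sum>k = 2..m. psi_coeff m k * psi k n) = of_nat n ^ m"
proof -
  have "monom 1 m = (\<Sum>k = 2..m. smult (psi_coeff m k) (psi_poly k))"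
    using is_psi_expansion_psi_coeff[OF assms(1)] by (simp add: is_psi_expansion_def)
  then have "poly (monom 1 m) (of_nat n) =
      poly (\<Sum>k = 2..m. smult (psi_coeff m k) (psi_poly k)) (of_nat n)"
    by simp
  then show ?thesis
    using assms(2) by (simp add: poly_monom poly_sum poly_psi_poly)
qed

text \<open>The nonlinear part of \<open>psi_poly k\<close> has the factor \<open>n - 1\<close>, so its derivative at \<open>1\<close> is the
  value of the cofactor there, \<open>(k - 1)! / (k - 2)! = k - 1\<close>.\<close>

lemma pderiv_psi_poly_1:
  assumes "k \<ge> 2"
  shows "poly (pderiv (psi_poly k)) 1 = of_nat k"
proof -
  obtain i where k: "k = Suc (Suc i)" using assms by (rule ge2_obtain)
  define P where "P = (\<Prod>j = 0..i. [:of_nat j, 1:] :: rat poly)"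
  have "poly P 1 = (\<Prod>j = 0..i. of_nat (Suc j))"
    by (simp add: P_def poly_prod add.commute)
  also have "\<dots> = fact (Suc i)"
    by (induction i) (simp_all add: algebra_simps)
  finally have P: "poly P 1 = (of_nat i + 1) * fact i" by (simp add: algebra_simps)
  have "psi_poly k = [:0, 1:] + smult (1 / fact i) ([:-1, 1:] * P)"
    by (simp add: psi_poly_def k P_def)
  then have "poly (pderiv (psi_poly k)) 1 = 1 + poly P 1 / fact i"
    by (simp add: pderiv_add pderiv_smult pderiv_mult pderiv_pCons del: mult_pCons_left)
  then show ?thesis by (simp add: P k)
qed

lemma first_moment_psi_coeff:
  assumes "m \<ge> 2"
  shows "(\<Sum>k = 2..m. psi_coeff m k * of_nat k) = of_nat m"
proof -
  have "monom 1 m = (\<Sum>k = 2..m. smult (psi_coeff m k) (psi_poly k))"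
    using is_psi_expansion_psi_coeff[OF assms] by (simp add: is_psi_expansion_def)
  then have "poly (pderiv (monom 1 m)) 1 =
      poly (pderiv (\<Sum>k = 2..m. smult (psi_coeff m k) (psi_poly k))) 1"
    by simp
  then show ?thesis
    by (simp add: pderiv_monom poly_monom higher_pderiv_sum[where n = 1, simplified] pderiv_smult poly_sum pderiv_psi_poly_1)
qed

lemma psi_1: "psi k 1 = 1"
  by (simp add: psi_def)

lemma psi_2:
  assumes "k \<ge> 1"
  shows "psi k 2 = 2 + of_nat k * (of_nat k - 1)"
proof -
  obtain i where "k = Suc i" using assms by (cases k) auto
  then show ?thesis by (simp add: psi_def B_def field_simps)
qed

lemma psi_3:
  assumes "k \<ge> 1"
  shows "psi k 3 = 3 + (of_nat k - 1) * of_nat k * (of_nat k + 1)"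
proof -
  obtain i where k: "k = Suc i" using assms by (cases k) auto
  have "fact (2 + i) = ((of_nat i + 2) * (of_nat i + 1) * fact i :: rat)"
    by (simp add: algebra_simps)
  then show ?thesis by (simp add: psi_def B_def k field_simps)
qed

theorem mainTheorem6:
  fixes m :: nat
  assumes "m \<ge> 2"
  shows "(T m 2 - of_nat m = (\<Sum>k = 2..m. psi_coeff m k * (of_nat k * (of_nat k - 1))) \<and>
          (\<Sum>k = 2..m. psi_coeff m k * (of_nat k * (of_nat k - 1))) = 2 ^ m - 2) \<and>
         (T m 3 - of_nat m = (\<Sum>k = 2..m. psi_coeff m k * ((of_nat k - 1) * of_nat k * (of_nat k + 1))) \<and>
          (\<Sum>k = 2..m. psi_coeff m k * ((of_nat k - 1) * of_nat k * (of_nat k + 1))) = 3 ^ m - 3)"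
proof -
  have total: "(\<Sum>k = 2..m. psi_coeff m k) = 1"
    using poly_psi_expansion[OF assms, of 1] by (simp add: psi_1[simplified])
  have shift: "(\<Sum>k = 2..m. psi_coeff m k * g k) = of_nat n ^ m - of_nat n"
    if "n \<ge> 1" "\<And>k. k \<ge> 1 \<Longrightarrow> psi k n = of_nat n + g k" for n g
  proof -
    have "of_nat n ^ m = (\<Sum>k = 2..m. psi_coeff m k * (of_nat n + g k))"
      unfolding poly_psi_expansion[OF assms \<open>n \<ge> 1\<close>, symmetric] by (rule sum.cong) (simp_all add: that(2))
    also have "\<dots> = of_nat n + (\<Sum>k = 2..m. psi_coeff m k * g k)"
      by (simp add: distrib_left sum.distrib total flip: sum_distrib_right)
    finally show ?thesis by simp
  qed
  have moment: "T m \<alpha> - of_nat m = (\<Sum>k = 2..m. psi_coeff m k * (of_nat k ^ \<alpha> - of_nat k))" for \<alpha>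
    by (simp add: T_def first_moment_psi_coeff[OF assms] right_diff_distrib sum_subtractf)
  have "T m 2 - of_nat m = (\<Sum>k = 2..m. psi_coeff m k * (of_nat k * (of_nat k - 1)))"
    unfolding moment by (simp add: power2_eq_square algebra_simps)
  moreover have "T m 3 - of_nat m =
      (\<Sum>k = 2..m. psi_coeff m k * ((of_nat k - 1) * of_nat k * (of_nat k + 1)))"
    unfolding moment by (simp add: power3_eq_cube algebra_simps)
  moreover have "(\<Sum>k = 2..m. psi_coeff m k * (of_nat k * (of_nat k - 1))) = 2 ^ m - 2"
    using shift[of 2 "\<lambda>k. of_nat k * (of_nat k - 1)"] by (simp add: psi_2)
  moreover have "(\<Sum>k = 2..m. psi_coeff m k * ((of_nat k - 1) * of_nat k * (of_nat k + 1))) = 3 ^ m - 3"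
    using shift[of 3 "\<lambda>k. (of_nat k - 1) * of_nat k * (of_nat k + 1)"] by (simp add: psi_3)
  ultimately show ?thesis by blast
qed

end
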